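(* Suppose $\frac{h_1}{\mu_1}\le\frac{h_2}{\mu_2}$. Consider decision states $(i,k,\ell)$, i.e. $(i,k,\ell)\in\mathbb{X}$ with $i\ge 1$ (so $k+\ell=C_1$). 1. Suppose $\mu_1<\mu_2$. There exist finite thresholds $N_3(\ell)\in\mathbb{Z}_+$, depending on $\ell$ only, for $0\le\ell\le C_2-1$, such that the following holds. (a) If a job at Station 1 (independent station) is completed first (so $k\ge1$): (i) if $\ell<C_2$, there is an optimal policy of independent threshold type with finite threshold $N_3(\ell)+1$, i.e. it is optimal to choose independent service if $i<N_3(\ell)+1$ and collaborative service otherwise; (ii) if $\ell\ge C_2$, it is optimal to choose independent service for every $i\ge1$. (b) If a job at Station 2 (collaborative station) is completed first (so $\ell\ge1$): (i) if $\ell\le C_2$, there is an optimal policy of independent threshold type with finite threshold $N_3(\ell-1)+1$, i.e. it is optimal to choose independent service if $i<N_3(\ell-1)+1$ and collaborative service otherwise; (ii) if $\ell>C_2$, it is optimal to choose independent service for every $i\ge1$. 2. If $\mu_1\ge\mu_2$, it is optimal to choose independent service in every decision state, whichever station completes a job first.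
   Context: Let $C_1,C_2\ge1$ be integers with $C_2<C_1$ (numbers of Type-I and Type-II servers), $\mu_1,\mu_2>0$ (service rates at Station 1, the independent service station, and Station 2, the collaborative service station) and $h_0,h_1,h_2>0$ (holding costs per job per unit time in the initial queue, at Station 1 and at Station 2). Write $\mathbb{Z}_+=\{0,1,2,\dots\}$. The state space is $$\mathbb{X}=\{(i,k,\ell)\in\mathbb{Z}_+^3 : (i=0 \text{ and } k+\ell<C_1)\text{ or }(i\ge0\text{ and }k+\ell=C_1)\},$$ where $i$ is the number of jobs in the initial queue, $k$ the number of jobs in service at Station 1 and $\ell$ the number of jobs at Station 2 (in service or waiting there). There are no arrivals. Service is non-preemptive with exponential times: Station 1 completes services at total rate $k\mu_1$ and Station 2 at total rate $\min\{\ell,C_2\}\mu_2$; put $d(k,\ell)=k\mu_1+\min\{\ell,C_2\}\mu_2$. Decisions: in a state $(i,k,\ell)$ with $i\ge1$, when a service completes the freed Type-I server takes the next queued job and chooses independent service (Station 1) or collaborative service (Station 2). If a Station 1 job is completed first, the next state is $(i-1,k,\ell)$ under independent and $(i-1,k-1,\ell+1)$ under collaborative service. If a Station 2 job is completed first, the next state is $(i-1,k+1,\ell-1)$ under independent and $(i-1,k,\ell)$ under collaborative service. The value function $v:\mathbb{X}\to\mathbb{R}$ is the minimal expected total holding cost until the system is empty. It satisfies $v(0,0,0)=0$, $$v(0,k,\ell)=\tfrac{kh_1+\ell h_2}{d(k,\ell)}+\tfrac{k\mu_1}{d(k,\ell)}v(0,k-1,\ell)+\tfrac{\min\{\ell,C_2\}\mu_2}{d(k,\ell)}v(0,k,\ell-1)\quad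 ((k,\ell)\ne(0,0)),$$ and for $i\ge1$, $$v(i,k,\ell)=\tfrac{ih_0+kh_1+\ell h_2}{d(k,\ell)}+\tfrac{k\mu_1}{d(k,\ell)}\min\{v(i-1,k,\ell),v(i-1,k-1,\ell+1)\}+\tfrac{\min\{\ell,C_2\}\mu_2}{d(k,\ell)}\min\{v(i-1,k+1,\ell-1),v(i-1,k,\ell)\},$$ where terms with coefficient $0$ are read as $0$. A decision is optimal if the state it leads to attains the corresponding minimum; a policy is optimal if all of its decisions are. A policy is of independent threshold type with threshold $N$ if it chooses independent service when the number $i$ of jobs in queue is below $N$ and collaborative service otherwise. *)

theory Defs
  imports "HOL-Probability.Probability"
begin

text \<open>A state \<open>(i, k, l)\<close> records the queue length and the numbers of jobs at Stations 1 and 2.\<close>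

type_synonym state = "nat \<times> nat \<times> nat"

datatype station = Station1 | Station2

datatype service = Independent | Collaborative

text \<open>A policy assigns a service mode to a state and the station that completes a job first.
  It is only consulted when the queue is nonempty.\<close>

type_synonym policy = "state \<Rightarrow> station \<Rightarrow> service"

text \<open>The truncated subtractions below matter only for completions of rate 0.\<close>

fun next_state :: "state \<Rightarrow> station \<Rightarrow> service \<Rightarrow> state" where
  "next_state (0, k, l) Station1 a = (0, k - 1, l)"
| "next_state (0, k, l) Station2 a = (0, k, l - 1)"
| "next_state (Suc i, k, l) Station1 Independent = (i, k, l)"
| "next_state (Suc i, k, l) Station1 Collaborative = (i, k - 1, l + 1)"
| "next_state (Suc i, k, l) Station2 Independent = (i, k + 1, l - 1)"
| "next_state (Suc i, k, l) Station2 Collaborative = (i, k, l)"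

text \<open>The policy chooses independent service for queue lengths below \<open>N\<close> and collaborative service
  from \<open>N\<close> on, after completions at station \<open>c\<close> with \<open>k\<close> and \<open>l\<close> jobs at the stations.\<close>

definition independent_threshold :: "policy \<Rightarrow> station \<Rightarrow> nat \<Rightarrow> nat \<Rightarrow> nat \<Rightarrow> bool" where
  "independent_threshold \<pi> c k l N \<longleftrightarrow>
     (\<forall>i\<ge>1. \<pi> (i, k, l) c = (if i < N then Independent else Collaborative))"

locale collaborative_queue =
  fixes C1 C2 :: nat and \<mu>1 \<mu>2 h0 h1 h2 :: real
  assumes C2_pos: "1 \<le> C2" and C2_less: "C2 < C1"
    and \<mu>1_pos: "0 < \<mu>1" and \<mu>2_pos: "0 < \<mu>2"
    and h0_pos: "0 < h0" and h1_pos: "0 < h1" and h2_pos: "0 < h2"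
begin

definition state_space :: "state set" where
  "state_space = {(i, k, l). (i = 0 \<and> k + l < C1) \<or> (i \<ge> 0 \<and> k + l = C1)}"

fun completion_rate :: "state \<Rightarrow> station \<Rightarrow> real" where
  "completion_rate (i, k, l) Station1 = real k * \<mu>1"
| "completion_rate (i, k, l) Station2 = real (min l C2) * \<mu>2"

definition total_rate :: "state \<Rightarrow> real" where
  "total_rate s = completion_rate s Station1 + completion_rate s Station2"

fun holding_rate :: "state \<Rightarrow> real" where
  "holding_rate (i, k, l) = real i * h0 + real k * h1 + real l * h2"

text \<open>Competing exponential clocks: in a nonempty state, Station 1 completes first with probability
  \<open>completion_rate s Station1 / total_rate s\<close>. The empty state is absorbing.\<close>

definition first_completion :: "state \<Rightarrow> station pmf" where
  "first_completion s =
     map_pmf (\<lambda>b. if b then Station1 else Station2)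
       (bernoulli_pmf (completion_rate s Station1 / total_rate s))"

definition step :: "policy \<Rightarrow> state \<Rightarrow> state pmf" where
  "step \<pi> s = (if s = (0, 0, 0) then return_pmf s
     else map_pmf (\<lambda>c. next_state s c (\<pi> s c)) (first_completion s))"

primrec state_after :: "policy \<Rightarrow> state \<Rightarrow> nat \<Rightarrow> state pmf" where
  "state_after \<pi> s 0 = return_pmf s"
| "state_after \<pi> s (Suc n) = bind_pmf (state_after \<pi> s n) (step \<pi>)"

text \<open>The sojourn time in \<open>s\<close> is exponential with rate \<open>total_rate s\<close>, so a visit to \<open>s\<close> costs
  \<open>holding_rate s / total_rate s\<close> in expectation (0 in the empty state).\<close>

definition expected_cost :: "policy \<Rightarrow> state \<Rightarrow> real" where
  "expected_cost \<pi> s =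
     (\<Sum>n. measure_pmf.expectation (state_after \<pi> s n) (\<lambda>t. holding_rate t / total_rate t))"

definition v :: "state \<Rightarrow> real" where
  "v s = (INF \<pi>. expected_cost \<pi> s)"

definition optimal_decision :: "state \<Rightarrow> station \<Rightarrow> service \<Rightarrow> bool" where
  "optimal_decision s c a \<longleftrightarrow>
     v (next_state s c a) =
       min (v (next_state s c Independent)) (v (next_state s c Collaborative))"

fun decision_epoch :: "state \<Rightarrow> station \<Rightarrow> bool" where
  "decision_epoch (i, k, l) c \<longleftrightarrow>
     (i, k, l) \<in> state_space \<and> i \<ge> 1 \<and> (case c of Station1 \<Rightarrow> k \<ge> 1 | Station2 \<Rightarrow> l \<ge> 1)"

definition optimal_policy :: "policy \<Rightarrow> bool" where
  "optimal_policy \<pi> \<longleftrightarrow> (\<forall>s c. decision_epoch s c \<longrightarrow> optimal_decision s c (\<pi> s c))"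


subsection \<open>The optimality equations\<close>

fun jobs :: "state \<Rightarrow> nat" where
  "jobs (i, k, l) = i + k + l"

definition prob :: "state \<Rightarrow> station \<Rightarrow> real" where
  "prob s c = completion_rate s c / total_rate s"

lemma completion_rate_nonneg: "0 \<le> completion_rate s c"
  using \<mu>1_pos \<mu>2_pos by (cases s; cases c) auto

lemma total_rate_pos:
  assumes "s \<in> state_space" "s \<noteq> (0, 0, 0)"
  shows "0 < total_rate s"
proof -
  obtain i k l where s: "s = (i, k, l)" by (cases s)
  have "k > 0 \<or> l > 0"
    using assms s C2_less by (auto simp: state_space_def)
  then show ?thesis
  proof
    assume "k > 0"
    then have "0 < real k * \<mu>1" using \<mu>1_pos by simp
    moreover have "0 \<le> real (min l C2) * \<mu>2" using \<mu>2_pos by simp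
    ultimately show ?thesis unfolding s total_rate_def by simp
  next
    assume "l > 0"
    then have "0 < real (min l C2) * \<mu>2" using \<mu>2_pos C2_pos by simp
    moreover have "0 \<le> real k * \<mu>1" using \<mu>1_pos by simp
    ultimately show ?thesis unfolding s total_rate_def by simp
  qed
qed

lemma next_state_jobs:
  assumes "s \<in> state_space" "s \<noteq> (0, 0, 0)" "prob s c \<noteq> 0"
  shows "next_state s c a \<in> state_space" "Suc (jobs (next_state s c a)) = jobs s"
proof -
  obtain i k l where s: "s = (i, k, l)" by (cases s)
  have c: "(c = Station1 \<and> k > 0) \<or> (c = Station2 \<and> l > 0)"
    using assms(3) unfolding s prob_def by (cases c) auto
  show "next_state s c a \<in> state_space" "Suc (jobs (next_state s c a)) = jobs s"
    using assms(1) c unfolding s by (cases i; cases a; auto simp: state_space_def)+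
qed

lemma prob_sum:
  assumes "s \<in> state_space" "s \<noteq> (0, 0, 0)"
  shows "prob s Station2 = 1 - prob s Station1"
  using total_rate_pos[OF assms] by (simp add: prob_def total_rate_def field_simps)

lemma prob_nonneg: "s \<in> state_space \<Longrightarrow> s \<noteq> (0, 0, 0) \<Longrightarrow> 0 \<le> prob s c"
  unfolding prob_def using total_rate_pos completion_rate_nonneg by (simp add: less_imp_le)

lemma state_after_Suc':
  "state_after \<pi> s (Suc n) = bind_pmf (step \<pi> s) (\<lambda>t. state_after \<pi> t n)"
proof (induction n)
  case 0
  show ?case by (simp add: bind_return_pmf bind_return_pmf')
next
  case (Suc n)
  have "state_after \<pi> s (Suc (Suc n)) = bind_pmf (state_after \<pi> s (Suc n)) (step \<pi>)"
    by (simp only: state_after.simps)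
  also have "\<dots> = bind_pmf (step \<pi> s) (\<lambda>t. state_after \<pi> t (Suc n))"
    unfolding Suc.IH by (simp add: bind_assoc_pmf)
  finally show ?case .
qed

lemma state_after_empty: "state_after \<pi> (0, 0, 0) n = return_pmf (0, 0, 0)"
  by (induction n) (simp_all add: bind_return_pmf step_def)

lemma finite_set_state_after: "finite (set_pmf (state_after \<pi> s n))"
proof (induction n)
  case (Suc n)
  have "finite (set_pmf (step \<pi> t))" for t
    by (simp add: step_def first_completion_def)
  with Suc show ?case by simp
qed simp

definition stage_cost :: "policy \<Rightarrow> state \<Rightarrow> nat \<Rightarrow> real" where
  "stage_cost \<pi> s n =
     measure_pmf.expectation (state_after \<pi> s n) (\<lambda>t. holding_rate t / total_rate t)"

lemma stage_cost_0: "stage_cost \<pi> s 0 = holding_rate s / total_rate s"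
  by (simp add: stage_cost_def)

lemma stage_cost_empty: "stage_cost \<pi> (0, 0, 0) n = 0"
  by (simp add: stage_cost_def state_after_empty)

lemma stage_cost_Suc:
  assumes "s \<in> state_space" "s \<noteq> (0, 0, 0)"
  shows "stage_cost \<pi> s (Suc n) =
    prob s Station1 * stage_cost \<pi> (next_state s Station1 (\<pi> s Station1)) n +
    prob s Station2 * stage_cost \<pi> (next_state s Station2 (\<pi> s Station2)) n"
proof -
  let ?nx = "\<lambda>b. next_state s (if b then Station1 else Station2)
                   (\<pi> s (if b then Station1 else Station2))"
  have p: "0 \<le> prob s Station1" "prob s Station1 \<le> 1"
    using prob_nonneg[OF assms] prob_sum[OF assms] by (smt (verit))+
  have "state_after \<pi> s (Suc n) =
      bind_pmf (bernoulli_pmf (prob s Station1)) (\<lambda>b. state_after \<pi> (?nx b) n)"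
    unfolding state_after_Suc' using assms(2)
    by (simp add: step_def first_completion_def prob_def bind_map_pmf pmf.map_comp o_def)
  then have "stage_cost \<pi> s (Suc n) =
      (\<Sum>b\<in>UNIV. pmf (bernoulli_pmf (prob s Station1)) b *\<^sub>R stage_cost \<pi> (?nx b) n)"
    unfolding stage_cost_def
    by (simp only:) (rule pmf_expectation_bind; simp add: finite_set_state_after)
  then show ?thesis
    using p prob_sum[OF assms] by (simp add: UNIV_bool)
qed

lemma stage_cost_eq_0:
  "s \<in> state_space \<Longrightarrow> jobs s \<le> n \<Longrightarrow> stage_cost \<pi> s n = 0"
proof (induction n arbitrary: s)
  case 0
  then have "s = (0, 0, 0)" by (cases s) auto
  then show ?case by (simp add: stage_cost_empty)
next
  case (Suc n)
  show ?case
  proof (cases "s = (0, 0, 0)")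
    case True
    then show ?thesis by (simp add: stage_cost_empty)
  next
    case False
    have "prob s c * stage_cost \<pi> (next_state s c a) n = 0" for c a
      using Suc.IH[of "next_state s c a"] next_state_jobs[OF Suc.prems(1) False, of c a]
        Suc.prems(2)
      by (cases "prob s c = 0") auto
    then show ?thesis
      unfolding stage_cost_Suc[OF Suc.prems(1) False] by (simp only: add_0)
  qed
qed

lemma summable_stage_cost: "s \<in> state_space \<Longrightarrow> summable (stage_cost \<pi> s)"
  by (rule summable_finite[of "{..<jobs s}"]) (auto intro: stage_cost_eq_0)

lemma expected_cost_eq: "expected_cost \<pi> s = (\<Sum>n. stage_cost \<pi> s n)"
  by (simp add: expected_cost_def stage_cost_def)

lemma expected_cost_empty: "expected_cost \<pi> (0, 0, 0) = 0"
  by (simp add: expected_cost_eq stage_cost_empty)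

lemma expected_cost_first_step:
  assumes "s \<in> state_space" "s \<noteq> (0, 0, 0)"
  shows "expected_cost \<pi> s = holding_rate s / total_rate s +
    prob s Station1 * expected_cost \<pi> (next_state s Station1 (\<pi> s Station1)) +
    prob s Station2 * expected_cost \<pi> (next_state s Station2 (\<pi> s Station2))"
proof -
  have sums: "(\<lambda>n. prob s c * stage_cost \<pi> (next_state s c a) n) sums
      (prob s c * expected_cost \<pi> (next_state s c a))" for c a
  proof (cases "prob s c = 0")
    case False
    then have "next_state s c a \<in> state_space"
      using next_state_jobs assms by blast
    then show ?thesis
      unfolding expected_cost_eq by (intro sums_mult summable_sums summable_stage_cost)
  qed simp
  have "(\<lambda>n. stage_cost \<pi> s (Suc n)) sums
    (prob s Station1 * expected_cost \<pi> (next_state s Station1 (\<pi> s Station1)) +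
     prob s Station2 * expected_cost \<pi> (next_state s Station2 (\<pi> s Station2)))"
    unfolding stage_cost_Suc[OF assms] by (intro sums_add sums)
  then show ?thesis
    unfolding expected_cost_eq using suminf_split_head[OF summable_stage_cost[OF assms(1), of \<pi>]]
    by (simp add: sums_iff stage_cost_0)
qed

primrec bellman :: "nat \<Rightarrow> state \<Rightarrow> real" where
  "bellman 0 s = 0"
| "bellman (Suc n) s = holding_rate s / total_rate s +
    prob s Station1 * min (bellman n (next_state s Station1 Independent))
                          (bellman n (next_state s Station1 Collaborative)) +
    prob s Station2 * min (bellman n (next_state s Station2 Independent))
                          (bellman n (next_state s Station2 Collaborative))"

definition greedy :: policy where
  "greedy s c = (if bellman (jobs s - 1) (next_state s c Independent)
                      \<le> bellman (jobs s - 1) (next_state s c Collaborative)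
                 then Independent else Collaborative)"

lemma bellman_le:
  "s \<in> state_space \<Longrightarrow> jobs s = n \<Longrightarrow> bellman n s \<le> expected_cost \<pi> s"
proof (induction n arbitrary: s)
  case 0
  then have "s = (0, 0, 0)" by (cases s) auto
  then show ?case by (simp add: expected_cost_empty)
next
  case (Suc n)
  have ne: "s \<noteq> (0, 0, 0)" using Suc.prems by auto
  have *: "prob s c * min (bellman n (next_state s c Independent))
                          (bellman n (next_state s c Collaborative))
      \<le> prob s c * expected_cost \<pi> (next_state s c (\<pi> s c))" for c
  proof (cases "prob s c = 0")
    case False
    have "bellman n (next_state s c (\<pi> s c)) \<le> expected_cost \<pi> (next_state s c (\<pi> s c))"
      using next_state_jobs[OF Suc.prems(1) ne False, of "\<pi> s c"] Suc.prems(2)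
      by (intro Suc.IH) auto
    then have "min (bellman n (next_state s c Independent))
        (bellman n (next_state s c Collaborative)) \<le> expected_cost \<pi> (next_state s c (\<pi> s c))"
      by (cases "\<pi> s c") auto
    then show ?thesis
      by (rule mult_left_mono) (rule prob_nonneg[OF Suc.prems(1) ne])
  qed simp
  show ?case
    unfolding expected_cost_first_step[OF Suc.prems(1) ne] bellman.simps
    using *[of Station1] *[of Station2] by linarith
qed

lemma bellman_greedy:
  "s \<in> state_space \<Longrightarrow> jobs s = n \<Longrightarrow> expected_cost greedy s = bellman n s"
proof (induction n arbitrary: s)
  case 0
  then have "s = (0, 0, 0)" by (cases s) auto
  then show ?case by (simp add: expected_cost_empty)
next
  case (Suc n)
  have ne: "s \<noteq> (0, 0, 0)" using Suc.prems by auto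
  have *: "prob s c * expected_cost greedy (next_state s c (greedy s c)) =
      prob s c * min (bellman n (next_state s c Independent))
                     (bellman n (next_state s c Collaborative))" for c
  proof (cases "prob s c = 0")
    case False
    have "expected_cost greedy (next_state s c (greedy s c)) =
        bellman n (next_state s c (greedy s c))"
      using next_state_jobs[OF Suc.prems(1) ne False, of "greedy s c"] Suc.prems(2)
      by (intro Suc.IH) auto
    also have "\<dots> = min (bellman n (next_state s c Independent))
                        (bellman n (next_state s c Collaborative))"
      using Suc.prems(2) by (simp add: greedy_def min_def)
    finally show ?thesis by simp
  qed simp
  show ?case
    unfolding expected_cost_first_step[OF Suc.prems(1) ne] bellman.simps * ..
qed

lemma v_eq_bellman:
  assumes "s \<in> state_space"
  shows "v s = bellman (jobs s) s"
  unfolding v_def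
  using bellman_le[OF assms refl] bellman_greedy[OF assms refl]
  by (intro cInf_eq_minimum) (auto simp: image_iff intro: sym)

lemma v_attained:
  assumes "s \<in> state_space"
  shows "expected_cost greedy s = v s" "v s \<le> expected_cost \<pi> s"
  using bellman_le[OF assms refl] bellman_greedy[OF assms refl] v_eq_bellman[OF assms] by simp_all

lemma v_first_step:
  assumes "s \<in> state_space" "s \<noteq> (0, 0, 0)"
  shows "v s = holding_rate s / total_rate s +
    prob s Station1 * min (v (next_state s Station1 Independent))
                          (v (next_state s Station1 Collaborative)) +
    prob s Station2 * min (v (next_state s Station2 Independent))
                          (v (next_state s Station2 Collaborative))"
proof -
  obtain n where n: "jobs s = Suc n"
    using assms(2) by (cases s; cases "jobs s") auto
  have *: "prob s c * min (bellman n (next_state s c Independent))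
                     (bellman n (next_state s c Collaborative)) =
     prob s c * min (v (next_state s c Independent)) (v (next_state s c Collaborative))" for c
  proof (cases "prob s c = 0")
    case False
    have "bellman n (next_state s c a) = v (next_state s c a)" for a
      using next_state_jobs[OF assms False, of a] n by (simp add: v_eq_bellman)
    then show ?thesis by simp
  qed simp
  show ?thesis
    using v_eq_bellman[OF assms(1)] unfolding n bellman.simps * .
qed

theorem v_empty: "v (0, 0, 0) = 0"
  by (simp add: v_def expected_cost_empty)

theorem v_queue_empty:
  assumes "(0, k, l) \<in> state_space" "(k, l) \<noteq> (0, 0)"
  shows "v (0, k, l) =
    (real k * h1 + real l * h2) / (real k * \<mu>1 + real (min l C2) * \<mu>2) +
    real k * \<mu>1 / (real k * \<mu>1 + real (min l C2) * \<mu>2) * v (0, k - 1, l) +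
    real (min l C2) * \<mu>2 / (real k * \<mu>1 + real (min l C2) * \<mu>2) * v (0, k, l - 1)"
  using v_first_step[OF assms(1)] assms(2) by (simp add: prob_def total_rate_def)

theorem v_queue_nonempty:
  assumes "(i, k, l) \<in> state_space" "i \<ge> 1"
  shows "v (i, k, l) =
    (real i * h0 + real k * h1 + real l * h2) / (real k * \<mu>1 + real (min l C2) * \<mu>2) +
    real k * \<mu>1 / (real k * \<mu>1 + real (min l C2) * \<mu>2) *
      min (v (i - 1, k, l)) (v (i - 1, k - 1, l + 1)) +
    real (min l C2) * \<mu>2 / (real k * \<mu>1 + real (min l C2) * \<mu>2) *
      min (v (i - 1, k + 1, l - 1)) (v (i - 1, k, l))"
proof -
  obtain j where "i = Suc j" using assms(2) by (cases i) auto
  then show ?thesis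
    using v_first_step[OF assms(1)] by (simp add: prob_def total_rate_def)
qed

end

end

theory Submission
  imports Defs
begin

text \<open>
  Before and after every decision all \<open>C1\<close> Type-I servers are busy, so the state is
  given by the queue length \<open>i\<close> and the number \<open>l\<close> of jobs at Station 2.
  A decision that leaves \<open>i\<close> jobs in the queue, after a completion at either station,
  compares two neighbouring values of \<open>busy_value i\<close>: independent service is optimal
  iff \<open>busy_value i l \<le> busy_value i (Suc l)\<close> for the appropriate
  \<open>l\<close>. Hence everything is a statement about the sign of
  \<open>busy_value i (Suc l) - busy_value i l\<close>.

  Moving a job from Station 1 to Station 2 changes the total service rate by
  \<open>\<mu>2 - \<mu>1\<close> if a Type-II server is available, and by \<open>-\<mu>1\<close>
  otherwise. Where this change is not positive, the move does not shorten the wait of the queued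
  jobs, and it does not make the moved job itself cheaper, since
  \<open>h1 / \<mu>1 \<le> h2 / \<mu>2\<close>; so independent service is optimal there for every
  queue length (\<open>busy_value_le_Suc\<close>). The induction needs that one more queued job
  costs at least the \<open>h1 / \<mu>1\<close> of its cheapest service
  (\<open>queue_increment_ge\<close>).

  If \<open>\<mu>1 < \<mu>2\<close> and \<open>l < C2\<close>, the move speeds the system up,
  which pays off only if enough jobs are waiting. Precisely, the cost
  \<open>queue_increment i l\<close> of one more queued job satisfies a recursion in
  \<open>i\<close> (\<open>service_rate_queue_increment\<close>) that preserves antitonicity in
  \<open>l \<le> C2\<close>, and the waiting cost \<open>h0\<close> opens in every step a gap of
  at least \<open>(\<mu>2 - \<mu>1) * h0 / (service_rate l * service_rate (Suc l))\<close> between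
  neighbours (\<open>queue_increment_gap\<close>). That gap is exactly the decrease of
  \<open>busy_value i (Suc l) - busy_value i l\<close> when \<open>i\<close> grows by one. A
  sequence decreasing by at least a fixed positive amount is negative exactly from some finite
  index on, which is the threshold (\<open>threshold_exists\<close>).
\<close>

lemma mult_weighted_sum:
  fixes d :: real
  assumes "0 < d"
  shows "d * (a / d + b / d * x + c / d * y) = a + b * x + c * y"
  using assms by (simp add: distrib_left)

context collaborative_queue
begin

section \<open>The value function on busy states\<close>

definition busy_value :: "nat \<Rightarrow> nat \<Rightarrow> real" where
  "busy_value i l = v (i, C1 - l, l)"

definition service_rate :: "nat \<Rightarrow> real" where
  "service_rate l = real (C1 - l) * \<mu>1 + real (min l C2) * \<mu>2"

text \<open>The value after the freed server has chosen, if \<open>l\<close> jobs remain at Station 2 under independent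
  service. A completion at Station 1 with \<open>l\<close> jobs at Station 2 leads to \<open>decision_value i l\<close>, one at
  Station 2 to \<open>decision_value i (l - 1)\<close>.\<close>

definition decision_value :: "nat \<Rightarrow> nat \<Rightarrow> real" where
  "decision_value i l = min (busy_value i l) (busy_value i (Suc l))"

lemma service_rate_pos: "l \<le> C1 \<Longrightarrow> 0 < service_rate l"
  using total_rate_pos[of "(0, C1 - l, l)"] C2_less
  by (auto simp: state_space_def total_rate_def service_rate_def)

lemma service_rate_Suc:
  assumes "l < C1"
  shows "service_rate (Suc l) = service_rate l - \<mu>1 + (if l < C2 then \<mu>2 else 0)"
proof -
  have "real (C1 - l) = real (C1 - Suc l) + 1" using assms by linarith
  then show ?thesis by (auto simp: service_rate_def min_def algebra_simps)
qed

lemma service_rate_busy_value_Suc: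
  assumes "l \<le> C1"
  shows "service_rate l * busy_value (Suc i) l =
    real (Suc i) * h0 + real (C1 - l) * h1 + real l * h2 +
    real (C1 - l) * \<mu>1 * decision_value i l +
    real (min l C2) * \<mu>2 * decision_value i (l - 1)"
proof -
  let ?d = "service_rate l"
  let ?V = "min (v (i, C1 - l + 1, l - 1)) (v (i, C1 - l, l))"
  have d: "0 < ?d" by (rule service_rate_pos[OF assms])
  have st: "(Suc i, C1 - l, l) \<in> state_space" using assms by (simp add: state_space_def)
  have 1: "min (v (i, C1 - l, l)) (v (i, C1 - l - 1, l + 1)) = decision_value i l"
    by (simp add: decision_value_def busy_value_def)
  have 2: "real (min l C2) * \<mu>2 * ?V = real (min l C2) * \<mu>2 * decision_value i (l - 1)"
  proof (cases l)
    case (Suc j)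
    then have "C1 - l + 1 = C1 - (l - 1)" using assms by simp
    then show ?thesis using Suc by (simp add: decision_value_def busy_value_def)
  qed simp
  have eq: "busy_value (Suc i) l =
      (real (Suc i) * h0 + real (C1 - l) * h1 + real l * h2) / ?d +
      real (C1 - l) * \<mu>1 / ?d * decision_value i l + real (min l C2) * \<mu>2 / ?d * ?V"
    using v_queue_nonempty[OF st] unfolding 1[symmetric]
    by (simp add: busy_value_def service_rate_def)
  have "?d * busy_value (Suc i) l =
      real (Suc i) * h0 + real (C1 - l) * h1 + real l * h2 +
      real (C1 - l) * \<mu>1 * decision_value i l + real (min l C2) * \<mu>2 * ?V"
    unfolding eq by (rule mult_weighted_sum[OF d])
  then show ?thesis unfolding 2 .
qed

text \<open>Without a queue the two stations do not interact: each job at Station 1 costs \<open>h1 / \<mu>1\<close>, and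
  Station 2 is emptied through its successive levels \<open>j\<close>.\<close>

lemma v_queue_empty_closed:
  assumes "k + l \<le> C1"
  shows "v (0, k, l) = real k * (h1 / \<mu>1) + (\<Sum>j=1..l. real j * h2 / (real (min j C2) * \<mu>2))"
  using assms
proof (induction "k + l" arbitrary: k l)
  case 0
  then show ?case by (simp add: v_empty)
next
  case (Suc n)
  let ?f = "\<lambda>l. \<Sum>j=1..l. real j * h2 / (real (min j C2) * \<mu>2)"
  let ?m = "real (min l C2) * \<mu>2"
  let ?d = "real k * \<mu>1 + ?m"
  have st: "(0, k, l) \<in> state_space" using Suc.prems by (auto simp: state_space_def)
  have "(0, k, l) \<noteq> (0, 0, 0)" using Suc.hyps(2) by auto
  then have d: "0 < ?d" using total_rate_pos[OF st] by (simp add: total_rate_def)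
  have 1: "real k * \<mu>1 * v (0, k - 1, l) = real k * \<mu>1 * (real k * (h1 / \<mu>1) + ?f l) - real k * h1"
  proof (cases k)
    case k: (Suc k')
    have "v (0, k', l) = real k' * (h1 / \<mu>1) + ?f l"
      using Suc.hyps Suc.prems k by (intro Suc.hyps(1)) auto
    then have "v (0, k - 1, l) = real k * (h1 / \<mu>1) + ?f l - h1 / \<mu>1"
      using k by (simp add: algebra_simps add_divide_distrib)
    then show ?thesis using \<mu>1_pos by (simp add: right_diff_distrib)
  qed simp
  have 2: "?m * v (0, k, l - 1) = ?m * (real k * (h1 / \<mu>1) + ?f l) - real l * h2"
  proof (cases l)
    case l: (Suc l')
    have "v (0, k, l') = real k * (h1 / \<mu>1) + ?f l'"
      using Suc.hyps Suc.prems l by (intro Suc.hyps(1)) auto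
    moreover have "?f l = ?f l' + real l * h2 / ?m" using l by simp
    ultimately have "v (0, k, l - 1) = real k * (h1 / \<mu>1) + ?f l - real l * h2 / ?m"
      using l by simp
    moreover have "?m * (real l * h2 / ?m) = real l * h2"
      using l C2_pos \<mu>2_pos by simp
    ultimately show ?thesis by (simp only: right_diff_distrib)
  qed simp
  have ne: "(k, l) \<noteq> (0, 0)" using Suc.hyps(2) by auto
  have "?d * v (0, k, l) = real k * h1 + real l * h2
      + real k * \<mu>1 * v (0, k - 1, l) + ?m * v (0, k, l - 1)"
    unfolding v_queue_empty[OF st ne] by (rule mult_weighted_sum[OF d])
  also have "\<dots> = ?d * (real k * (h1 / \<mu>1) + ?f l)"
    unfolding 1 2 by (simp add: distrib_right)
  finally show ?case using d by simp
qed

lemma busy_value_0_Suc: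
  assumes "l < C1"
  shows "busy_value 0 (Suc l) =
    busy_value 0 l - h1 / \<mu>1 + real (Suc l) * h2 / (real (min (Suc l) C2) * \<mu>2)"
proof -
  have "real (C1 - l) = real (C1 - Suc l) + 1" using assms by linarith
  then have "real (C1 - l) * (h1 / \<mu>1) = real (C1 - Suc l) * (h1 / \<mu>1) + h1 / \<mu>1"
    by (simp only: distrib_right mult_1)
  moreover have "(\<Sum>j=1..Suc l. f j) = (\<Sum>j=1..l. f j) + f (Suc l)" for f :: "nat \<Rightarrow> real"
    by simp
  moreover have "C1 - l + l \<le> C1" "C1 - Suc l + Suc l \<le> C1" using assms by auto
  ultimately show ?thesis
    unfolding busy_value_def by (simp only: v_queue_empty_closed)
qed

lemma service_rate_busy_value_0:
  assumes "l \<le> C1"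
  shows "service_rate l * busy_value 0 l = real (C1 - l) * h1 + real l * h2 +
    real (C1 - l) * \<mu>1 * (busy_value 0 l - h1 / \<mu>1) +
    real (min l C2) * \<mu>2 * (busy_value 0 (l - 1) - h1 / \<mu>1)"
proof (cases l)
  case 0
  then show ?thesis using \<mu>1_pos by (simp add: service_rate_def field_simps)
next
  case (Suc j)
  define m where "m = real (min l C2) * \<mu>2"
  have m: "0 < m" using Suc C2_pos \<mu>2_pos by (simp add: m_def)
  have "busy_value 0 l = busy_value 0 j - h1 / \<mu>1 + real l * h2 / m"
    using busy_value_0_Suc[of j] assms Suc by (simp add: m_def)
  then have "m * busy_value 0 l = m * (busy_value 0 j - h1 / \<mu>1) + real l * h2"
    using m by (simp add: distrib_left)
  then show ?thesis
    using Suc \<mu>1_pos unfolding service_rate_def m_def[symmetric] by (simp add: algebra_simps)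
qed

section \<open>The cost of one more queued job\<close>

definition queue_increment :: "nat \<Rightarrow> nat \<Rightarrow> real" where
  "queue_increment i l = busy_value (Suc i) l - busy_value i l"

text \<open>At \<open>0\<close> this is what the last queued job costs once its server has been chosen: with a cheapest
  service at Station 1 it contributes \<open>h1 / \<mu>1\<close>, whatever \<open>l\<close> is.\<close>

fun decision_increment :: "nat \<Rightarrow> nat \<Rightarrow> real" where
  "decision_increment 0 l = h1 / \<mu>1"
| "decision_increment (Suc i) l = decision_value (Suc i) l - decision_value i l"

context
  assumes cheaper: "h1 / \<mu>1 \<le> h2 / \<mu>2"
begin

lemma busy_value_0_le_Suc:
  assumes "l < C1"
  shows "busy_value 0 l \<le> busy_value 0 (Suc l)"
proof -
  let ?m = "real (min (Suc l) C2) * \<mu>2"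
  have m: "0 < ?m" using C2_pos \<mu>2_pos by simp
  have "?m * (h2 / \<mu>2) \<le> real (Suc l) * h2"
    using \<mu>2_pos h2_pos by (simp add: mult_right_mono)
  then have "h2 / \<mu>2 \<le> real (Suc l) * h2 / ?m"
    using m by (simp add: pos_le_divide_eq mult.commute)
  then show ?thesis using busy_value_0_Suc[OF assms] cheaper by linarith
qed

text \<open>Subtract consecutive optimality equations. For \<open>i = 0\<close> the earlier equation is the one of the
  empty queue, where the freed server stays idle. Independent service is optimal for the last job,
  so giving it to that server costs exactly \<open>h1 / \<mu>1\<close> more.\<close>

lemma service_rate_queue_increment:
  assumes "l \<le> C1"
  shows "service_rate l * queue_increment i l = h0 +
    real (C1 - l) * \<mu>1 * decision_increment i l +
    real (min l C2) * \<mu>2 * decision_increment i (l - 1)"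
proof (cases i)
  case 0
  have 1: "real (C1 - l) * \<mu>1 * decision_value 0 l = real (C1 - l) * \<mu>1 * busy_value 0 l"
    using busy_value_0_le_Suc[of l] by (cases "l < C1") (simp_all add: decision_value_def min_def)
  have 2: "real (min l C2) * \<mu>2 * decision_value 0 (l - 1) =
      real (min l C2) * \<mu>2 * busy_value 0 (l - 1)"
    using busy_value_0_le_Suc[of "l - 1"] assms
    by (cases "l = 0") (simp_all add: decision_value_def min_def)
  show ?thesis
    using service_rate_busy_value_Suc[OF assms, of 0] service_rate_busy_value_0[OF assms]
    unfolding 1 2 by (simp add: 0 queue_increment_def algebra_simps)
next
  case (Suc j)
  show ?thesis
    using service_rate_busy_value_Suc[OF assms, of i] service_rate_busy_value_Suc[OF assms, of j]
    unfolding Suc by (simp add: queue_increment_def algebra_simps)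
qed

text \<open>The increment is a weighted mean of later increments plus a waiting cost, and the last queued
  job costs at least \<open>h1 / \<mu>1\<close> wherever it is served.\<close>

lemma queue_increment_ge:
  assumes "l \<le> C1"
  shows "h1 / \<mu>1 \<le> queue_increment i l"
proof -
  have mean: "h1 / \<mu>1 \<le> queue_increment i l"
    if E: "\<And>j. j < C1 \<Longrightarrow> h1 / \<mu>1 \<le> decision_increment i j" and l: "l \<le> C1" for i l
  proof -
    have 1: "real (C1 - l) * \<mu>1 * (h1 / \<mu>1) \<le> real (C1 - l) * \<mu>1 * decision_increment i l"
    proof (cases "l < C1")
      case True
      then show ?thesis using E[of l] \<mu>1_pos by (intro mult_left_mono) auto
    qed simp
    have 2: "real (min l C2) * \<mu>2 * (h1 / \<mu>1) \<le>
        real (min l C2) * \<mu>2 * decision_increment i (l - 1)"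
    proof (cases "l = 0")
      case False
      then show ?thesis using E[of "l - 1"] l \<mu>2_pos by (intro mult_left_mono) auto
    qed simp
    have "service_rate l * (h1 / \<mu>1) =
        real (C1 - l) * \<mu>1 * (h1 / \<mu>1) + real (min l C2) * \<mu>2 * (h1 / \<mu>1)"
      by (simp only: service_rate_def distrib_right)
    also have "\<dots> \<le> service_rate l * queue_increment i l"
      using 1 2 h0_pos unfolding service_rate_queue_increment[OF l] by linarith
    finally show ?thesis
      by (rule mult_left_le_imp_le) (rule service_rate_pos[OF l])
  qed
  have "h1 / \<mu>1 \<le> decision_increment i j" if "j < C1" for j
    using that
  proof (induction i arbitrary: j)
    case (Suc i)
    have "h1 / \<mu>1 \<le> queue_increment i j" "h1 / \<mu>1 \<le> queue_increment i (Suc j)"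
      using mean[of i] Suc by auto
    then show ?case by (simp add: decision_value_def queue_increment_def min_def)
  qed simp
  then show ?thesis using mean assms by blast
qed

section \<open>Moving a job to Station 2 without gaining speed\<close>

text \<open>Let \<open>\<delta>\<close> be the rate gained at Station 2, so \<open>\<delta> \<le> \<mu>1\<close>. In the difference of the two optimality
  equations the service lost, at rate \<open>\<mu>1 - \<delta>\<close>, delays the start of a queued job, which costs at
  least \<open>h1 / \<mu>1\<close> each time; together with the change \<open>h2 - h1\<close> of the holding cost this leaves
  \<open>h2 - \<delta> * h1 / \<mu>1\<close>, which is nonnegative as \<open>\<delta> \<le> \<mu>2\<close>.\<close>

lemma busy_value_le_Suc:
  assumes "\<mu>2 \<le> \<mu>1 \<or> C2 \<le> l" "l < C1"
  shows "busy_value i l \<le> busy_value i (Suc l)"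
  using assms
proof (induction i arbitrary: l)
  case 0
  then show ?case by (simp add: busy_value_0_le_Suc)
next
  case (Suc i)
  define k where "k = real (C1 - Suc l)"
  define m where "m = real (min l C2) * \<mu>2"
  define \<delta> where "\<delta> = (if l < C2 then \<mu>2 else 0)"
  have \<delta>: "0 \<le> \<delta>" "\<delta> \<le> \<mu>1" "\<delta> \<le> \<mu>2" using Suc.prems(1) \<mu>1_pos \<mu>2_pos by (auto simp: \<delta>_def)
  have k: "real (C1 - l) = k + 1" using Suc.prems(2) by (simp add: k_def)
  have m': "real (min (Suc l) C2) * \<mu>2 = m + \<delta>"
    by (simp add: m_def \<delta>_def min_def algebra_simps)
  have d: "service_rate (Suc l) = service_rate l - \<mu>1 + \<delta>"
    using service_rate_Suc[OF Suc.prems(2)] by (simp add: \<delta>_def)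
  have W: "decision_value i l = busy_value i l"
    using Suc.IH[OF Suc.prems] by (simp add: decision_value_def)
  have "0 \<le> k * \<mu>1 * (decision_value i (Suc l) - decision_value i l)"
  proof (cases "Suc l < C1")
    case True
    then have "busy_value i (Suc l) \<le> busy_value i (Suc (Suc l))"
      using Suc.prems(1) by (intro Suc.IH) auto
    then have "decision_value i l \<le> decision_value i (Suc l)" by (simp add: decision_value_def)
    then show ?thesis using \<mu>1_pos by (simp add: k_def)
  qed (simp add: k_def)
  moreover have "0 \<le> m * (decision_value i l - decision_value i (l - 1))"
  proof (cases l)
    case (Suc j)
    then have "decision_value i (l - 1) \<le> busy_value i l" by (simp add: decision_value_def)
    then show ?thesis using W \<mu>2_pos by (simp add: m_def)
  qed simp
  moreover have "0 \<le> (\<mu>1 - \<delta>) * (busy_value (Suc i) (Suc l) - busy_value i l) + (h2 - h1)"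
  proof -
    have "h1 / \<mu>1 \<le> busy_value (Suc i) (Suc l) - busy_value i l"
      using queue_increment_ge[of "Suc l" i] Suc.IH[OF Suc.prems] Suc.prems(2)
      by (simp add: queue_increment_def)
    then have "(\<mu>1 - \<delta>) * (h1 / \<mu>1) \<le> (\<mu>1 - \<delta>) * (busy_value (Suc i) (Suc l) - busy_value i l)"
      using \<delta>(2) by (intro mult_left_mono) auto
    moreover have "(\<mu>1 - \<delta>) * (h1 / \<mu>1) = h1 - \<delta> * (h1 / \<mu>1)"
      using \<mu>1_pos by (simp add: field_simps)
    moreover have "\<delta> * (h1 / \<mu>1) \<le> \<mu>2 * (h2 / \<mu>2)"
      using \<delta> cheaper h1_pos \<mu>1_pos \<mu>2_pos by (intro mult_mono) auto
    moreover have "\<mu>2 * (h2 / \<mu>2) = h2" using \<mu>2_pos by simp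
    ultimately show ?thesis by linarith
  qed
  moreover have "service_rate l * (busy_value (Suc i) (Suc l) - busy_value (Suc i) l) =
      k * \<mu>1 * (decision_value i (Suc l) - decision_value i l) +
      m * (decision_value i l - decision_value i (l - 1)) +
      ((\<mu>1 - \<delta>) * (busy_value (Suc i) (Suc l) - busy_value i l) + (h2 - h1))"
    using service_rate_busy_value_Suc[of "Suc l" i] service_rate_busy_value_Suc[of l i] Suc.prems(2)
    unfolding k m' d W k_def[symmetric] m_def[symmetric]
    by (simp add: W algebra_simps)
  ultimately have "0 \<le> service_rate l * (busy_value (Suc i) (Suc l) - busy_value (Suc i) l)"
    by linarith
  then show ?case
    using service_rate_pos[of l] Suc.prems(2) by (simp add: zero_le_mult_iff)
qed

section \<open>Moving a job to Station 2 with a gain of speed\<close>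

text \<open>Compare the recursions at \<open>l\<close> and \<open>Suc l\<close>. By antitonicity \<open>queue_increment i l\<close> exceeds
  \<open>decision_increment i l\<close> by at least \<open>h0 / service_rate l\<close>, and at \<open>Suc l\<close> the additional rate
  \<open>\<mu>2 - \<mu>1\<close> falls on \<open>decision_increment i l\<close>.\<close>

lemma queue_increment_gap:
  assumes "\<mu>1 \<le> \<mu>2" "l < C2"
    and anti: "antimono_on {..C2} (decision_increment i)"
  shows "(\<mu>2 - \<mu>1) * h0 / (service_rate l * service_rate (Suc l))
    \<le> queue_increment i l - queue_increment i (Suc l)"
proof -
  define k where "k = real (C1 - Suc l)"
  define d where "d = service_rate l"
  let ?E = "decision_increment i" and ?B = "queue_increment i"
  have l: "l < C1" using assms(2) C2_less by simp
  have k: "real (C1 - l) = k + 1" using l by (simp add: k_def)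
  have d_pos: "0 < d" "0 < service_rate (Suc l)" using l by (simp_all add: d_def service_rate_pos)
  have d': "service_rate (Suc l) = d + (\<mu>2 - \<mu>1)"
    using service_rate_Suc[OF l] assms(2) by (simp add: d_def)
  have d_eq: "d = (k + 1) * \<mu>1 + real l * \<mu>2"
    using assms(2) by (simp add: d_def service_rate_def k)
  have E: "?E (Suc l) \<le> ?E l" "?E l \<le> ?E (l - 1)"
    using assms(2) by (auto intro!: monotone_onD[OF anti])
  have B: "d * ?B l = h0 + (k + 1) * \<mu>1 * ?E l + real l * \<mu>2 * ?E (l - 1)"
    using service_rate_queue_increment[of l i] l assms(2) by (simp add: d_def k)
  have B': "service_rate (Suc l) * ?B (Suc l) =
      h0 + k * \<mu>1 * ?E (Suc l) + real (Suc l) * \<mu>2 * ?E l"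
    using service_rate_queue_increment[of "Suc l" i] l assms(2) by (simp add: k_def)
  have nn: "0 \<le> k * \<mu>1 * (?E l - ?E (Suc l))" "0 \<le> real l * \<mu>2 * (?E (l - 1) - ?E l)"
    using E \<mu>1_pos \<mu>2_pos by (simp_all add: k_def)
  have "h0 \<le> d * (?B l - ?E l)"
    using nn(2) B by (simp add: d_eq algebra_simps)
  then have "h0 / d \<le> ?B l - ?E l"
    using d_pos by (simp add: pos_divide_le_eq mult.commute)
  then have "(\<mu>2 - \<mu>1) * (h0 / d) \<le> (\<mu>2 - \<mu>1) * (?B l - ?E l)"
    using assms(1) by (intro mult_left_mono) auto
  also have "\<dots> \<le> service_rate (Suc l) * (?B l - ?B (Suc l))"
  proof -
    have "service_rate (Suc l) * (?B l - ?B (Suc l)) =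
        d * ?B l + (\<mu>2 - \<mu>1) * ?B l - service_rate (Suc l) * ?B (Suc l)"
      by (simp add: d' algebra_simps)
    also have "\<dots> = (\<mu>2 - \<mu>1) * (?B l - ?E l) + k * \<mu>1 * (?E l - ?E (Suc l)) +
        real l * \<mu>2 * (?E (l - 1) - ?E l)"
      unfolding B B' by (simp add: algebra_simps)
    finally show ?thesis using nn by linarith
  qed
  finally have "(\<mu>2 - \<mu>1) * (h0 / d) / service_rate (Suc l) \<le> ?B l - ?B (Suc l)"
    using d_pos by (simp add: pos_divide_le_eq mult.commute)
  then show ?thesis by (simp add: d_def)
qed

text \<open>A difference of minima of two consecutive values lies between the two differences. This lets
  antitonicity pass from \<open>queue_increment i\<close> to \<open>decision_increment (Suc i)\<close>; at \<open>C2\<close>, where the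
  upper neighbour is no longer controlled, the minimum is known to be attained at \<open>C2\<close>.\<close>

lemma antimono_decision_increment:
  assumes "\<mu>1 \<le> \<mu>2"
  shows "antimono_on {..C2} (decision_increment i)"
proof (induction i)
  case 0
  show ?case by (simp add: monotone_on_def)
next
  case (Suc i)
  let ?E = "decision_increment (Suc i)" and ?B = "queue_increment i"
  have step: "?B (Suc l) \<le> ?B l" if "l < C2" for l
  proof -
    have "0 \<le> (\<mu>2 - \<mu>1) * h0 / (service_rate l * service_rate (Suc l))"
      using assms h0_pos service_rate_pos[of l] service_rate_pos[of "Suc l"] that C2_less
      by simp
    then show ?thesis using queue_increment_gap[OF assms that Suc.IH] by linarith
  qed
  have between: "?B (Suc l) \<le> ?E l" "?E l \<le> ?B l" if "l < C2" for l
    using step[OF that] by (simp_all add: decision_value_def queue_increment_def min_def)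
  have top: "?E C2 = ?B C2"
    using busy_value_le_Suc[of C2] C2_less by (simp add: decision_value_def queue_increment_def)
  have E_step: "?E (Suc l) \<le> ?E l" if "l < C2" for l
  proof -
    have "?E (Suc l) \<le> ?B (Suc l)"
    proof (cases "Suc l = C2")
      case True
      then show ?thesis using top by simp
    next
      case False
      then show ?thesis using between(2)[of "Suc l"] that by simp
    qed
    then show ?thesis using between(1)[OF that] by linarith
  qed
  have "?E n \<le> ?E m" if "m \<le> n" "n \<le> C2" for m n
    using that
  proof (induction n rule: dec_induct)
    case (step n)
    then show ?case using E_step[of n] by simp
  qed simp
  then show ?case by (intro monotone_onI) auto
qed

text \<open>The increment of \<open>busy_value i (Suc l) - busy_value i l\<close> in \<open>i\<close> is
  \<open>queue_increment i (Suc l) - queue_increment i l\<close>, which stays below a negative number that does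
  not depend on \<open>i\<close>.\<close>

lemma threshold_exists:
  assumes "\<mu>1 < \<mu>2" "l < C2"
  shows "\<exists>N. \<forall>i. busy_value i l \<le> busy_value i (Suc l) \<longleftrightarrow> i < N"
proof -
  define D where "D i = busy_value i (Suc l) - busy_value i l" for i
  define c where "c = (\<mu>2 - \<mu>1) * h0 / (service_rate l * service_rate (Suc l))"
  have c: "0 < c"
    unfolding c_def using assms h0_pos service_rate_pos[of l] service_rate_pos[of "Suc l"] C2_less
    by simp
  have step: "D (Suc i) \<le> D i - c" for i
    using queue_increment_gap[OF less_imp_le[OF assms(1)] assms(2)
        antimono_decision_increment[OF less_imp_le[OF assms(1)]], of i]
    by (simp add: D_def c_def queue_increment_def)
  have bound: "D i \<le> D 0 - real i * c" for i
  proof (induction i)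
    case (Suc i)
    then show ?case using step[of i] by (simp add: algebra_simps)
  qed simp
  obtain n where "D 0 < real n * c" using reals_Archimedean3[OF c] by blast
  then have "D n < 0" using bound[of n] by linarith
  then have neg: "D (LEAST i. D i < 0) < 0" by (rule LeastI)
  have "antimono D"
    using step c by (intro decseq_SucI) (smt (verit))
  then have "D i < 0" if "(LEAST i. D i < 0) \<le> i" for i
    using neg decseqD[of D, OF _ that] by fastforce
  then have "0 \<le> D i \<longleftrightarrow> i < (LEAST i. D i < 0)" for i
    using not_less_Least[of i "\<lambda>i. D i < 0"] by (meson not_le)
  then show ?thesis by (auto simp: D_def)
qed

end

section \<open>Decisions in terms of the values on busy states\<close>

lemma optimal_decision_Independent_iff:
  "optimal_decision s c Independent \<longleftrightarrow>
    v (next_state s c Independent) \<le> v (next_state s c Collaborative)"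
  by (auto simp: optimal_decision_def min_def)

lemma v_le_iff_busy_value_Station1:
  assumes "k + l = C1" "1 \<le> i"
  shows "v (next_state (i, k, l) Station1 Independent) \<le> v (next_state (i, k, l) Station1 Collaborative)
    \<longleftrightarrow> busy_value (i - 1) l \<le> busy_value (i - 1) (Suc l)"
proof -
  have "k = C1 - l" "k - 1 = C1 - Suc l" using assms(1) by auto
  then show ?thesis using assms(2) by (cases i) (simp_all add: busy_value_def)
qed

lemma v_le_iff_busy_value_Station2:
  assumes "k + l = C1" "1 \<le> i" "1 \<le> l"
  shows "v (next_state (i, k, l) Station2 Independent) \<le> v (next_state (i, k, l) Station2 Collaborative)
    \<longleftrightarrow> busy_value (i - 1) (l - 1) \<le> busy_value (i - 1) l"
proof -
  have "k = C1 - l" "k + 1 = C1 - (l - 1)" using assms by auto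
  then show ?thesis using assms(2) by (cases i) (simp_all add: busy_value_def)
qed

lemma decision_epoch_Independent:
  assumes "h1 / \<mu>1 \<le> h2 / \<mu>2" "decision_epoch (i, k, l) c"
    and "\<mu>2 \<le> \<mu>1 \<or> C2 \<le> (case c of Station1 \<Rightarrow> l | Station2 \<Rightarrow> l - 1)"
  shows "optimal_decision (i, k, l) c Independent"
proof -
  have kl: "k + l = C1" "1 \<le> i" using assms(2) by (auto simp: state_space_def)
  show ?thesis
  proof (cases c)
    case Station1
    then have "l < C1" using assms(2) kl by auto
    then have "busy_value (i - 1) l \<le> busy_value (i - 1) (Suc l)"
      using Station1 assms(3) by (intro busy_value_le_Suc[OF assms(1)]) auto
    then show ?thesis
      using Station1 v_le_iff_busy_value_Station1[OF kl]
      by (simp only: optimal_decision_Independent_iff)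
  next
    case Station2
    then have l: "1 \<le> l" using assms(2) by auto
    then have "busy_value (i - 1) (l - 1) \<le> busy_value (i - 1) (Suc (l - 1))"
      using Station2 assms(3) kl by (intro busy_value_le_Suc[OF assms(1)]) auto
    then show ?thesis
      using Station2 v_le_iff_busy_value_Station2[OF kl l] l
      by (simp add: optimal_decision_Independent_iff)
  qed
qed

definition ties_independent :: policy where
  "ties_independent s c =
    (if v (next_state s c Independent) \<le> v (next_state s c Collaborative)
     then Independent else Collaborative)"

lemma optimal_policy_ties_independent: "optimal_policy ties_independent"
  by (auto simp: optimal_policy_def optimal_decision_def ties_independent_def min_def)

end

section \<open>The structure of optimal policies\<close>

theorem theorem3p2:
  fixes C1 C2 :: nat and \<mu>1 \<mu>2 h0 h1 h2 :: real
  assumes "collaborative_queue C1 C2 \<mu>1 \<mu>2 h0 h1 h2"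
    and "h1 / \<mu>1 \<le> h2 / \<mu>2"
  shows "(\<mu>1 < \<mu>2 \<longrightarrow>
      (\<exists>(N3 :: nat \<Rightarrow> nat) (\<pi> :: policy).
        collaborative_queue.optimal_policy C1 C2 \<mu>1 \<mu>2 h0 h1 h2 \<pi> \<and>
        (\<forall>k l. k + l = C1 \<and> k \<ge> 1 \<and> l < C2 \<longrightarrow>
          independent_threshold \<pi> Station1 k l (N3 l + 1)) \<and>
        (\<forall>i k l. collaborative_queue.decision_epoch C1 (i, k, l) Station1 \<and> l \<ge> C2 \<longrightarrow>
          collaborative_queue.optimal_decision C2 \<mu>1 \<mu>2 h0 h1 h2 (i, k, l) Station1 Independent) \<and>
        (\<forall>k l. k + l = C1 \<and> l \<ge> 1 \<and> l \<le> C2 \<longrightarrow>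
          independent_threshold \<pi> Station2 k l (N3 (l - 1) + 1)) \<and>
        (\<forall>i k l. collaborative_queue.decision_epoch C1 (i, k, l) Station2 \<and> l > C2 \<longrightarrow>
          collaborative_queue.optimal_decision C2 \<mu>1 \<mu>2 h0 h1 h2 (i, k, l) Station2 Independent)))
    \<and> (\<mu>1 \<ge> \<mu>2 \<longrightarrow>
      (\<forall>s c. collaborative_queue.decision_epoch C1 s c \<longrightarrow>
        collaborative_queue.optimal_decision C2 \<mu>1 \<mu>2 h0 h1 h2 s c Independent))"
proof -
  interpret collaborative_queue C1 C2 \<mu>1 \<mu>2 h0 h1 h2 by (fact assms(1))
  show ?thesis
  proof (intro conjI impI)
    assume "\<mu>1 < \<mu>2"
    then have "\<forall>l. \<exists>N. l < C2 \<longrightarrow> (\<forall>i. busy_value i l \<le> busy_value i (Suc l) \<longleftrightarrow> i < N)"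
      using threshold_exists[OF assms(2)] by blast
    then obtain N3 where N3:
      "\<And>l i. l < C2 \<Longrightarrow> busy_value i l \<le> busy_value i (Suc l) \<longleftrightarrow> i < N3 l"
      by metis
    \<comment> \<open>The threshold \<open>N3 l\<close> counts the jobs left in the queue after the decision; the \<open>+ 1\<close> is the
      job about to enter service.\<close>
    have 1: "independent_threshold ties_independent Station1 k l (N3 l + 1)"
      if "k + l = C1" "l < C2" for k l
      unfolding independent_threshold_def ties_independent_def
      using v_le_iff_busy_value_Station1[OF that(1)] N3[OF that(2)] by auto
    have 2: "independent_threshold ties_independent Station2 k l (N3 (l - 1) + 1)"
      if "k + l = C1" "1 \<le> l" "l \<le> C2" for k l
      unfolding independent_threshold_def ties_independent_def
      using v_le_iff_busy_value_Station2[OF that(1) _ that(2)] N3[of "l - 1"] that by auto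
    show "\<exists>(N3 :: nat \<Rightarrow> nat) \<pi>. optimal_policy \<pi> \<and>
        (\<forall>k l. k + l = C1 \<and> k \<ge> 1 \<and> l < C2 \<longrightarrow>
          independent_threshold \<pi> Station1 k l (N3 l + 1)) \<and>
        (\<forall>i k l. decision_epoch (i, k, l) Station1 \<and> l \<ge> C2 \<longrightarrow>
          optimal_decision (i, k, l) Station1 Independent) \<and>
        (\<forall>k l. k + l = C1 \<and> l \<ge> 1 \<and> l \<le> C2 \<longrightarrow>
          independent_threshold \<pi> Station2 k l (N3 (l - 1) + 1)) \<and>
        (\<forall>i k l. decision_epoch (i, k, l) Station2 \<and> l > C2 \<longrightarrow>
          optimal_decision (i, k, l) Station2 Independent)"
    proof (intro exI conjI allI impI; (elim conjE)?)
      show "optimal_policy ties_independent" by (rule optimal_policy_ties_independent)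
    next
      fix i k l
      assume "decision_epoch (i, k, l) Station1" "l \<ge> C2"
      then show "optimal_decision (i, k, l) Station1 Independent"
        by (intro decision_epoch_Independent assms(2)) auto
    next
      fix i k l
      assume "decision_epoch (i, k, l) Station2" "l > C2"
      then show "optimal_decision (i, k, l) Station2 Independent"
        by (intro decision_epoch_Independent assms(2)) auto
    qed (rule 1 2; assumption)+
  next
    assume "\<mu>2 \<le> \<mu>1"
    then show "\<forall>s c. decision_epoch s c \<longrightarrow> optimal_decision s c Independent"
      using decision_epoch_Independent[OF assms(2)] by (metis prod_cases3)
  qed
qed

end
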